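(* Let $\mathscr{I}^{\nearrow}_{\infty}(\mathbb{Z})$ be the monoid of all injective monotone partial selfmaps of $\mathbb{Z}$ with cofinite domain and cofinite range, and let $\tau_W$ be the topology on it for which, for every $\alpha$, the sets $$U_\alpha(F)=\{\beta\in\mathscr{I}^{\nearrow}_{\infty}(\mathbb{Z})\mid \operatorname{dom}\beta\subseteq\operatorname{dom}\alpha\text{ and }(x)\beta=(x)\alpha\text{ for all }x\in F\},$$ with $F$ ranging over the finite subsets of $\operatorname{dom}\alpha$, form a base of neighbourhoods at $\alpha$ (the collection of all sets $U_\alpha(F)$ being a base of $\tau_W$). Then $(\mathscr{I}^{\nearrow}_{\infty}(\mathbb{Z}),\tau_W)$ is a Tychonoff topological inverse semigroup.
   Context: A partial map $\alpha\colon\mathbb{Z}\rightharpoonup\mathbb{Z}$ is monotone if $n\leqslant m$ implies $(n)\alpha\leqslant(m)\alpha$ for $n,m\in\operatorname{dom}\alpha$. $\mathscr{I}^{\nearrow}_{\infty}(\mathbb{Z})$ is the set of all injective monotone partial maps $\alpha\colon\mathbb{Z}\rightharpoonup\mathbb{Z}$ with $|\mathbb{Z}\setminus\operatorname{dom}\alpha|<\infty$ and $|\mathbb{Z}\setminus\operatorname{ran}\alpha|<\infty$, with composition $x(\alpha\beta)=(x\alpha)\beta$ for $x\in\operatorname{dom}(\alpha\beta)=\{y\in\operatorname{dom}\alpha\mid y\alpha\in\operatorname{dom}\beta\}$ (maps are written on the right). It is an inverse monoid; the inverse of $\alpha$ is the inverse partial map. A topological inverse semigroup is an inverse semigroup with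 a Hausdorff topology such that the semigroup operation is jointly continuous and the inversion $x\mapsto x^{-1}$ is continuous. *)

theory Defs
  imports "HOL-Analysis.Analysis" "HOL-Algebra.Group"
begin

section \<open>Topological inverse semigroups\<close>

text \<open>HOL-Algebra has no record of semigroups, so they are read off \<^typ>\<open>('a, 'b) monoid_scheme\<close>,
  of which only the carrier and the multiplication are used.\<close>

definition is_inverse_of :: "('a, 'b) monoid_scheme \<Rightarrow> 'a \<Rightarrow> 'a \<Rightarrow> bool" where
  "is_inverse_of S x y \<longleftrightarrow>
     y \<in> carrier S \<and> x \<otimes>\<^bsub>S\<^esub> y \<otimes>\<^bsub>S\<^esub> x = x \<and> y \<otimes>\<^bsub>S\<^esub> x \<otimes>\<^bsub>S\<^esub> y = y"

locale inverse_semigroup =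
  fixes S :: "('a, 'b) monoid_scheme" (structure)
  assumes closed: "\<lbrakk>x \<in> carrier S; y \<in> carrier S\<rbrakk> \<Longrightarrow> x \<otimes> y \<in> carrier S"
    and assoc: "\<lbrakk>x \<in> carrier S; y \<in> carrier S; z \<in> carrier S\<rbrakk>
                 \<Longrightarrow> (x \<otimes> y) \<otimes> z = x \<otimes> (y \<otimes> z)"
    and unique_inverse: "x \<in> carrier S \<Longrightarrow> \<exists>!y. is_inverse_of S x y"

text \<open>This is the semigroup inverse, unlike \<^const>\<open>m_inv\<close>, which is the inverse of a unit.\<close>

definition semigroup_inv :: "('a, 'b) monoid_scheme \<Rightarrow> 'a \<Rightarrow> 'a" where
  "semigroup_inv S x = (THE y. is_inverse_of S x y)"

locale topological_inverse_semigroup = inverse_semigroup S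
  for S :: "('a, 'b) monoid_scheme" (structure) and X :: "'a topology" +
  assumes topspace: "topspace X = carrier S"
    and Hausdorff: "Hausdorff_space X"
    and continuous_mult: "continuous_map (prod_topology X X) X (\<lambda>(x, y). x \<otimes> y)"
    and continuous_inv: "continuous_map X X (semigroup_inv S)"

definition tychonoff_space :: "'a topology \<Rightarrow> bool" where
  "tychonoff_space X \<longleftrightarrow> t1_space X \<and> completely_regular_space X"


section \<open>The monoid of cofinite monotone partial injections of the integers\<close>

definition cofinite_monotone_injections :: "(int \<rightharpoonup> int) set" where
  "cofinite_monotone_injections =
     {\<alpha>. inj_on \<alpha> (dom \<alpha>) \<and>
         (\<forall>n\<in>dom \<alpha>. \<forall>m\<in>dom \<alpha>. n \<le> m \<longrightarrow> the (\<alpha> n) \<le> the (\<alpha> m)) \<and>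
         finite (UNIV - dom \<alpha>) \<and> finite (UNIV - ran \<alpha>)}"

text \<open>Maps act on the right: in the product \<open>\<alpha> \<otimes> \<beta>\<close> the map \<open>\<alpha>\<close> is applied first,
  whereas \<^const>\<open>map_comp\<close> applies its second argument first.\<close>

definition I_inf_Z :: "(int \<rightharpoonup> int) monoid" where
  "I_inf_Z = \<lparr>carrier = cofinite_monotone_injections, mult = (\<lambda>\<alpha> \<beta>. \<beta> \<circ>\<^sub>m \<alpha>), one = Some\<rparr>"

lemma map_comp_closed:
  assumes a: "\<alpha> \<in> cofinite_monotone_injections" and b: "\<beta> \<in> cofinite_monotone_injections"
  shows "\<beta> \<circ>\<^sub>m \<alpha> \<in> cofinite_monotone_injections"
proof -
  have inj_a: "x = y" if "\<alpha> x = Some u" "\<alpha> y = Some u" for x y u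
    using a that by (auto simp: cofinite_monotone_injections_def inj_on_def dom_def)
  have inj_b: "x = y" if "\<beta> x = Some u" "\<beta> y = Some u" for x y u
    using b that by (auto simp: cofinite_monotone_injections_def inj_on_def dom_def)
  have "inj_on (\<beta> \<circ>\<^sub>m \<alpha>) (dom (\<beta> \<circ>\<^sub>m \<alpha>))"
  proof (rule inj_onI)
    fix x y assume "x \<in> dom (\<beta> \<circ>\<^sub>m \<alpha>)" and eq: "(\<beta> \<circ>\<^sub>m \<alpha>) x = (\<beta> \<circ>\<^sub>m \<alpha>) y"
    then obtain w where w: "(\<beta> \<circ>\<^sub>m \<alpha>) x = Some w" by blast
    with eq have "(\<beta> \<circ>\<^sub>m \<alpha>) y = Some w" by simp
    with w obtain u v where *: "\<alpha> x = Some u" "\<beta> u = Some w" "\<alpha> y = Some v" "\<beta> v = Some w"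
      unfolding map_comp_Some_iff by blast
    have "u = v" using *(2,4) by (rule inj_b)
    with *(3) have "\<alpha> y = Some u" by simp
    with *(1) show "x = y" by (rule inj_a)
  qed
  moreover have "\<forall>n\<in>dom (\<beta> \<circ>\<^sub>m \<alpha>). \<forall>m\<in>dom (\<beta> \<circ>\<^sub>m \<alpha>). n \<le> m \<longrightarrow>
      the ((\<beta> \<circ>\<^sub>m \<alpha>) n) \<le> the ((\<beta> \<circ>\<^sub>m \<alpha>) m)"
  proof (intro ballI impI)
    fix n m assume "n \<in> dom (\<beta> \<circ>\<^sub>m \<alpha>)" "m \<in> dom (\<beta> \<circ>\<^sub>m \<alpha>)" and le: "n \<le> m"
    then obtain u v u' v' where *: "\<alpha> n = Some u" "\<beta> u = Some u'" "\<alpha> m = Some v" "\<beta> v = Some v'"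
      by (auto simp: map_comp_Some_iff)
    have "\<And>n m. n \<in> dom \<alpha> \<Longrightarrow> m \<in> dom \<alpha> \<Longrightarrow> n \<le> m \<Longrightarrow> the (\<alpha> n) \<le> the (\<alpha> m)"
      using a by (simp add: cofinite_monotone_injections_def)
    from this[of n m] have "u \<le> v" using le *(1,3) by (simp add: domI)
    moreover have "\<And>n m. n \<in> dom \<beta> \<Longrightarrow> m \<in> dom \<beta> \<Longrightarrow> n \<le> m \<Longrightarrow> the (\<beta> n) \<le> the (\<beta> m)"
      using b by (simp add: cofinite_monotone_injections_def)
    from this[of u v] have "u \<le> v \<Longrightarrow> u' \<le> v'" using *(2,4) by (simp add: domI)
    ultimately have "u' \<le> v'" by blast
    with * show "the ((\<beta> \<circ>\<^sub>m \<alpha>) n) \<le> the ((\<beta> \<circ>\<^sub>m \<alpha>) m)" by simp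
  qed
  moreover have "finite (UNIV - dom (\<beta> \<circ>\<^sub>m \<alpha>))"
  proof (rule finite_subset)
    have "finite (Some ` (UNIV - dom \<beta>))" "inj_on \<alpha> (dom \<alpha>)"
      using a b by (simp_all add: cofinite_monotone_injections_def)
    then have "finite (\<alpha> -` (Some ` (UNIV - dom \<beta>)) \<inter> dom \<alpha>)"
      by (rule finite_vimage_IntI)
    then show "finite ((UNIV - dom \<alpha>) \<union> (\<alpha> -` (Some ` (UNIV - dom \<beta>)) \<inter> dom \<alpha>))"
      using a by (simp add: cofinite_monotone_injections_def)
    show "UNIV - dom (\<beta> \<circ>\<^sub>m \<alpha>) \<subseteq> (UNIV - dom \<alpha>) \<union> (\<alpha> -` (Some ` (UNIV - dom \<beta>)) \<inter> dom \<alpha>)"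
    proof
      fix x assume "x \<in> UNIV - dom (\<beta> \<circ>\<^sub>m \<alpha>)"
      then have "(\<beta> \<circ>\<^sub>m \<alpha>) x = None" by (simp add: domIff)
      then show "x \<in> (UNIV - dom \<alpha>) \<union> (\<alpha> -` (Some ` (UNIV - dom \<beta>)) \<inter> dom \<alpha>)"
        unfolding map_comp_None_iff by (elim disjE exE) (simp_all add: domIff)
    qed
  qed
  moreover have "finite (UNIV - ran (\<beta> \<circ>\<^sub>m \<alpha>))"
  proof (rule finite_subset)
    show "finite ((UNIV - ran \<beta>) \<union> (\<lambda>y. the (\<beta> y)) ` (UNIV - ran \<alpha>))"
      using a b by (simp add: cofinite_monotone_injections_def)
    show "UNIV - ran (\<beta> \<circ>\<^sub>m \<alpha>) \<subseteq> (UNIV - ran \<beta>) \<union> (\<lambda>y. the (\<beta> y)) ` (UNIV - ran \<alpha>)"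
    proof
      fix z assume z: "z \<in> UNIV - ran (\<beta> \<circ>\<^sub>m \<alpha>)"
      show "z \<in> (UNIV - ran \<beta>) \<union> (\<lambda>y. the (\<beta> y)) ` (UNIV - ran \<alpha>)"
      proof (cases "z \<in> ran \<beta>")
        case True
        then obtain y where y: "\<beta> y = Some z" by (auto simp: ran_def)
        with z have "y \<notin> ran \<alpha>" by (auto simp: ran_def map_comp_Some_iff)
        then have "the (\<beta> y) \<in> (\<lambda>y. the (\<beta> y)) ` (UNIV - ran \<alpha>)" by (intro imageI) simp
        with y show ?thesis by simp
      qed simp
    qed
  qed
  ultimately show ?thesis by (simp add: cofinite_monotone_injections_def)
qed

lemma monoid_I_inf_Z: "monoid I_inf_Z"
proof
  show "\<one>\<^bsub>I_inf_Z\<^esub> \<in> carrier I_inf_Z"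
    by (simp add: I_inf_Z_def cofinite_monotone_injections_def dom_def ran_def)
  show "x \<otimes>\<^bsub>I_inf_Z\<^esub> y \<in> carrier I_inf_Z"
    if "x \<in> carrier I_inf_Z" "y \<in> carrier I_inf_Z" for x y
    using that by (simp add: I_inf_Z_def map_comp_closed)
qed (auto simp: I_inf_Z_def map_comp_def fun_eq_iff split: option.splits)


section \<open>The topology\<close>

text \<open>For \<open>F \<subseteq> dom \<alpha>\<close>, the equation \<open>\<beta> x = \<alpha> x\<close> between option values also says that
  \<open>x \<in> dom \<beta>\<close>.\<close>

definition U_nbhd :: "(int \<rightharpoonup> int) \<Rightarrow> int set \<Rightarrow> (int \<rightharpoonup> int) set" where
  "U_nbhd \<alpha> F = {\<beta> \<in> carrier I_inf_Z. dom \<beta> \<subseteq> dom \<alpha> \<and> (\<forall>x\<in>F. \<beta> x = \<alpha> x)}"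

definition tau_W_base :: "(int \<rightharpoonup> int) set set" where
  "tau_W_base = {U_nbhd \<alpha> F | \<alpha> F. \<alpha> \<in> carrier I_inf_Z \<and> finite F \<and> F \<subseteq> dom \<alpha>}"

definition tau_W :: "(int \<rightharpoonup> int) topology" where
  "tau_W = topology (arbitrary union_of (\<lambda>U. U \<in> tau_W_base))"

lemma U_nbhd_inside_base:
  assumes "U \<in> tau_W_base" and "\<beta> \<in> U"
  obtains F where "finite F" "F \<subseteq> dom \<beta>" "U_nbhd \<beta> F \<subseteq> U"
proof -
  obtain \<alpha> F where "U = U_nbhd \<alpha> F" "finite F" "F \<subseteq> dom \<alpha>"
    using assms(1) by (auto simp: tau_W_base_def)
  note U = this
  have sub: "dom \<beta> \<subseteq> dom \<alpha>" and eq: "\<And>x. x \<in> F \<Longrightarrow> \<beta> x = \<alpha> x"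
    using assms(2) by (simp_all add: U(1) U_nbhd_def)
  show thesis
  proof (rule that[of F])
    show "F \<subseteq> dom \<beta>"
    proof
      fix x assume "x \<in> F"
      with U(3) eq show "x \<in> dom \<beta>" by (metis domIff subsetD)
    qed
    show "U_nbhd \<beta> F \<subseteq> U"
      unfolding U(1) U_nbhd_def using subset_trans[OF _ sub] eq by simp blast
  qed (rule U(2))
qed

lemma istopology_tau_W: "istopology (arbitrary union_of (\<lambda>U. U \<in> tau_W_base))"
  unfolding istopology_base_eq
proof (intro allI impI, elim conjE)
  fix A B assume A: "A \<in> tau_W_base" and B: "B \<in> tau_W_base"
  have "\<exists>V. V \<in> tau_W_base \<and> \<beta> \<in> V \<and> V \<subseteq> A \<inter> B" if "\<beta> \<in> A \<inter> B" for \<beta>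
  proof -
    obtain F where F: "finite F" "F \<subseteq> dom \<beta>" "U_nbhd \<beta> F \<subseteq> A"
      using U_nbhd_inside_base[OF A, of \<beta>] \<open>\<beta> \<in> A \<inter> B\<close> by (elim IntE) metis
    obtain G where G: "finite G" "G \<subseteq> dom \<beta>" "U_nbhd \<beta> G \<subseteq> B"
      using U_nbhd_inside_base[OF B, of \<beta>] \<open>\<beta> \<in> A \<inter> B\<close> by (elim IntE) metis
    have c: "\<beta> \<in> carrier I_inf_Z"
      using that A by (auto simp: tau_W_base_def U_nbhd_def)
    have "U_nbhd \<beta> (F \<union> G) \<subseteq> U_nbhd \<beta> F \<inter> U_nbhd \<beta> G" by (auto simp: U_nbhd_def)
    then have "U_nbhd \<beta> (F \<union> G) \<subseteq> A \<inter> B" using F(3) G(3) by blast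
    moreover have "\<beta> \<in> U_nbhd \<beta> (F \<union> G)" using c by (simp add: U_nbhd_def)
    moreover have "U_nbhd \<beta> (F \<union> G) \<in> tau_W_base"
      unfolding tau_W_base_def using c F(1,2) G(1,2) by blast
    ultimately show ?thesis by blast
  qed
  then have "\<Union>{V \<in> tau_W_base. V \<subseteq> A \<inter> B} = A \<inter> B" by blast
  then show "(arbitrary union_of (\<lambda>U. U \<in> tau_W_base)) (A \<inter> B)"
    unfolding union_of_def arbitrary_def
    by (intro exI[of _ "{V \<in> tau_W_base. V \<subseteq> A \<inter> B}"]) simp
qed

lemma openin_tau_W: "openin tau_W = arbitrary union_of (\<lambda>U. U \<in> tau_W_base)"
  unfolding tau_W_def by (rule topology_inverse'[OF istopology_tau_W])

end

(* Since dom \<alpha> is cofinite, the condition dom \<beta> \<subseteq> dom \<alpha> in U_\<alpha>(F) only prescribes the value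
   "undefined" at finitely many points. Hence tau_W is the topology of pointwise convergence, the
   values (including "undefined") being discrete, and it is Tychonoff as a subspace of a product of
   discrete spaces. The product is continuous coordinate by coordinate. For the inversion, the
   delicate condition is y \<notin> ran \<alpha>: choosing a, b in dom \<alpha> with a \<alpha> < y < b \<alpha>, monotonicity shows
   that every \<beta> agreeing with \<alpha> on [a,b] also misses y. *)

theory Submission
  imports Defs
begin

text \<open>On a linear order, injectivity and monotonicity together amount to preserving and
  reflecting \<open><\<close>. In this form arguments and values play symmetric roles, so passing to
  the inverse map merely reads the equivalence backwards.\<close>

lemma carrier_iff: "\<alpha> \<in> carrier I_inf_Z \<longleftrightarrow>
  (\<forall>n m u v. \<alpha> n = Some u \<longrightarrow> \<alpha> m = Some v \<longrightarrow> (n < m \<longleftrightarrow> u < v)) \<and>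
  finite (- dom \<alpha>) \<and> finite (- ran \<alpha>)" (is "_ \<longleftrightarrow> ?strict \<and> _")
proof -
  have "inj_on \<alpha> (dom \<alpha>) \<and>
      (\<forall>n\<in>dom \<alpha>. \<forall>m\<in>dom \<alpha>. n \<le> m \<longrightarrow> the (\<alpha> n) \<le> the (\<alpha> m)) \<longleftrightarrow> ?strict" (is "?inj \<and> ?mono \<longleftrightarrow> _")
  proof (rule iffI; (intro allI impI)?)
    fix n m u v assume *: "?inj \<and> ?mono" and nm: "\<alpha> n = Some u" "\<alpha> m = Some v"
    have "n = m" if "u = v"
      using * nm that unfolding inj_on_def by (metis domI)
    moreover have "u \<le> v" if "n \<le> m"
      using * nm that by (metis domI option.sel)
    moreover have "v \<le> u" if "m \<le> n"
      using * nm that by (metis domI option.sel)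
    ultimately show "n < m \<longleftrightarrow> u < v" using nm by fastforce
  next
    assume s: ?strict
    have ?inj
    proof (rule inj_onI)
      fix n m assume "n \<in> dom \<alpha>" "m \<in> dom \<alpha>" "\<alpha> n = \<alpha> m"
      then obtain u where "\<alpha> n = Some u" "\<alpha> m = Some u" by auto
      with s show "n = m" by (metis less_irrefl linorder_neqE)
    qed
    moreover have ?mono
    proof (intro ballI impI)
      fix n m assume "n \<in> dom \<alpha>" "m \<in> dom \<alpha>" "n \<le> m"
      then obtain u v where "\<alpha> n = Some u" "\<alpha> m = Some v" "\<not> m < n" by auto
      with s have "\<not> v < u" by blast
      with \<open>\<alpha> n = Some u\<close> \<open>\<alpha> m = Some v\<close> show "the (\<alpha> n) \<le> the (\<alpha> m)" by simp
    qed
    ultimately show "?inj \<and> ?mono" by blast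
  qed
  then show ?thesis
    by (simp only: I_inf_Z_def partial_object.select_convs cofinite_monotone_injections_def
        mem_Collect_eq Compl_eq_Diff_UNIV conj_assoc[symmetric])
qed

lemma carrier_less_iff:
  assumes "\<alpha> \<in> carrier I_inf_Z" "\<alpha> n = Some u" "\<alpha> m = Some v"
  shows "n < m \<longleftrightarrow> u < v"
  using assms by (simp add: carrier_iff)

lemma carrier_inj:
  assumes "\<alpha> \<in> carrier I_inf_Z" "\<alpha> n = Some u" "\<alpha> m = Some u"
  shows "n = m"
  using carrier_less_iff[OF assms(1)] assms(2,3) by (meson less_irrefl linorder_neqE)

lemma mult_eq: "\<alpha> \<otimes>\<^bsub>I_inf_Z\<^esub> \<beta> = \<beta> \<circ>\<^sub>m \<alpha>"
  by (simp add: I_inf_Z_def)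


section \<open>The inverse semigroup structure\<close>

text \<open>The description operator selects the preimage correctly only when it is unique, so this
  is the inverse partial map for injective \<alpha>, in particular on the carrier.\<close>

definition map_inverse :: "('a \<rightharpoonup> 'b) \<Rightarrow> ('b \<rightharpoonup> 'a)" where
  "map_inverse \<alpha> y = (if y \<in> ran \<alpha> then Some (THE x. \<alpha> x = Some y) else None)"

lemma map_inverse_eq_Some_iff:
  assumes "\<alpha> \<in> carrier I_inf_Z"
  shows "map_inverse \<alpha> y = Some x \<longleftrightarrow> \<alpha> x = Some y"
proof -
  have *: "(THE z. \<alpha> z = Some y) = x" if "\<alpha> x = Some y" for x
    using that carrier_inj[OF assms] by blast
  then show ?thesis by (auto simp: map_inverse_def ran_def)
qed

text \<open>Inversion exchanges domain and range, and with them the two cofiniteness conditions; the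
  order condition of \<open>carrier_iff\<close> is symmetric.\<close>

lemma map_inverse_closed:
  assumes "\<alpha> \<in> carrier I_inf_Z"
  shows "map_inverse \<alpha> \<in> carrier I_inf_Z"
proof -
  note iff = map_inverse_eq_Some_iff[OF assms]
  have "dom (map_inverse \<alpha>) = ran \<alpha>" "ran (map_inverse \<alpha>) = dom \<alpha>"
    by (auto simp: dom_def ran_def iff)
  then show ?thesis using assms unfolding carrier_iff[of "map_inverse \<alpha>"] iff
    by (auto simp: carrier_iff)
qed

text \<open>Settles existence and uniqueness of inverses together: the two inverse equations force
  the graph of \<beta> to be the transposed graph of \<alpha>, and the transposed graph satisfies
  them.\<close>

lemma is_inverse_of_iff:
  assumes a: "\<alpha> \<in> carrier I_inf_Z"
  shows "is_inverse_of I_inf_Z \<alpha> \<beta> \<longleftrightarrow> \<beta> = map_inverse \<alpha>"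
proof
  assume inv: "is_inverse_of I_inf_Z \<alpha> \<beta>"
  \<comment> \<open>The equation makes \<beta> send y to some z with the same image y as x, and
    injectivity gives z = x. The maps are generalised because the exchanged pair yields the opposite
    inclusion of graphs.\<close>
  have half: "\<beta> y = Some x"
    if c: "\<alpha> \<in> carrier I_inf_Z" and "\<alpha> \<circ>\<^sub>m (\<beta> \<circ>\<^sub>m \<alpha>) = \<alpha>" and x: "\<alpha> x = Some y" for \<alpha> \<beta> :: "int \<rightharpoonup> int" and x y
  proof -
    have "(\<alpha> \<circ>\<^sub>m (\<beta> \<circ>\<^sub>m \<alpha>)) x = Some y" using that(2,3) by simp
    then obtain z where "\<beta> y = Some z" "\<alpha> z = Some y"
      using x by (auto simp: map_comp_Some_iff)
    with carrier_inj[OF c] x show ?thesis by metis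
  qed
  have "\<beta> y = Some x \<longleftrightarrow> \<alpha> x = Some y" for x y
    using inv half[of \<alpha> \<beta> x y] half[of \<beta> \<alpha> y x] a by (auto simp: is_inverse_of_def mult_eq)
  then have "\<beta> y = Some x \<longleftrightarrow> map_inverse \<alpha> y = Some x" for x y
    by (simp add: map_inverse_eq_Some_iff[OF a])
  then show "\<beta> = map_inverse \<alpha>"
    by (intro ext) (metis not_None_eq)
next
  note iff = map_inverse_eq_Some_iff[OF a]
  assume \<beta>: "\<beta> = map_inverse \<alpha>"
  have "(\<alpha> \<circ>\<^sub>m (\<beta> \<circ>\<^sub>m \<alpha>)) x = Some y \<longleftrightarrow> \<alpha> x = Some y" for x y
    unfolding \<beta> map_comp_Some_iff iff by auto
  then have "\<alpha> \<circ>\<^sub>m (\<beta> \<circ>\<^sub>m \<alpha>) = \<alpha>"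
    by (intro ext) (metis not_None_eq)
  moreover have "(\<beta> \<circ>\<^sub>m (\<alpha> \<circ>\<^sub>m \<beta>)) y = Some x \<longleftrightarrow> \<beta> y = Some x" for x y
    unfolding \<beta> map_comp_Some_iff iff using carrier_inj[OF a] by auto
  then have "\<beta> \<circ>\<^sub>m (\<alpha> \<circ>\<^sub>m \<beta>) = \<beta>"
    by (intro ext) (metis not_None_eq)
  ultimately show "is_inverse_of I_inf_Z \<alpha> \<beta>"
    using map_inverse_closed[OF a] by (simp add: is_inverse_of_def mult_eq \<beta>)
qed

lemma semigroup_inv_eq:
  "\<alpha> \<in> carrier I_inf_Z \<Longrightarrow> semigroup_inv I_inf_Z \<alpha> = map_inverse \<alpha>"
  by (simp add: semigroup_inv_def is_inverse_of_iff)

lemma inverse_semigroup_I_inf_Z: "inverse_semigroup I_inf_Z"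
proof -
  interpret monoid I_inf_Z by (rule monoid_I_inf_Z)
  show ?thesis by unfold_locales (auto simp: is_inverse_of_iff m_assoc)
qed


section \<open>The topology of pointwise convergence\<close>

text \<open>Singletons are open in a discrete space, so continuity into it is local constancy: every
  preimage is a union of open sets on which \<open>f\<close> is constant.\<close>

lemma continuous_map_discrete_iff:
  "continuous_map X (discrete_topology UNIV) f \<longleftrightarrow>
     (\<forall>x\<in>topspace X. \<exists>U. openin X U \<and> x \<in> U \<and> (\<forall>y\<in>U. f y = f x))" (is "?L \<longleftrightarrow> ?R")
proof
  assume ?L
  show ?R
  proof
    fix x assume "x \<in> topspace X"
    moreover have "openin X {y \<in> topspace X. f y \<in> {f x}}"
      using \<open>?L\<close> by (rule openin_continuous_map_preimage) simp
    ultimately show "\<exists>U. openin X U \<and> x \<in> U \<and> (\<forall>y\<in>U. f y = f x)" by blast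
  qed
next
  assume R: ?R
  have "openin X {x \<in> topspace X. f x \<in> V}" for V
  proof (subst openin_subopen, clarify)
    fix x assume x: "x \<in> topspace X" "f x \<in> V"
    with R obtain U where "openin X U" "x \<in> U" "\<forall>y\<in>U. f y = f x" by blast
    moreover from this have "U \<subseteq> {x \<in> topspace X. f x \<in> V}"
      using x(2) openin_subset[of X U] by fastforce
    ultimately show "\<exists>T. openin X T \<and> x \<in> T \<and> T \<subseteq> {x \<in> topspace X. f x \<in> V}"
      by blast
  qed
  then show ?L by (simp add: continuous_map_def)
qed

lemma openin_tau_W_iff:
  "openin tau_W S \<longleftrightarrow> S \<subseteq> carrier I_inf_Z \<and>
     (\<forall>\<alpha>\<in>S. \<exists>F. finite F \<and> {\<beta> \<in> carrier I_inf_Z. \<forall>x\<in>F. \<beta> x = \<alpha> x} \<subseteq> S)" (is "_ \<longleftrightarrow> ?R")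
proof
  assume "openin tau_W S"
  then have S: "\<And>\<alpha>. \<alpha> \<in> S \<Longrightarrow> \<exists>U\<in>tau_W_base. \<alpha> \<in> U \<and> U \<subseteq> S"
    unfolding openin_tau_W union_of_def arbitrary_def by blast
  show ?R
  proof (intro conjI ballI)
    show "S \<subseteq> carrier I_inf_Z"
      using S by (fastforce simp: tau_W_base_def U_nbhd_def)
    fix \<alpha> assume "\<alpha> \<in> S"
    then obtain U where U: "U \<in> tau_W_base" "\<alpha> \<in> U" "U \<subseteq> S" using S by blast
    then obtain F where F: "finite F" "U_nbhd \<alpha> F \<subseteq> U" using U_nbhd_inside_base by metis
    \<comment> \<open>Agreement on the complement of \<open>dom \<alpha>\<close> prescribes the
      value \<open>None\<close> there, which encodes the inclusion of domains; cofiniteness of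
      \<open>dom \<alpha>\<close> keeps the enlarged set finite.\<close>
    have "{\<beta> \<in> carrier I_inf_Z. \<forall>x\<in>F \<union> - dom \<alpha>. \<beta> x = \<alpha> x} \<subseteq> U_nbhd \<alpha> F"
    proof (clarsimp simp: U_nbhd_def)
      fix \<beta> x y assume "\<forall>x\<in>F \<union> - dom \<alpha>. \<beta> x = \<alpha> x" "\<beta> x = Some y"
      then show "\<exists>y. \<alpha> x = Some y" by (cases "x \<in> dom \<alpha>") auto
    qed
    moreover have "finite (F \<union> - dom \<alpha>)"
      using F(1) U(1,2) by (auto simp: tau_W_base_def U_nbhd_def carrier_iff)
    ultimately show "\<exists>F. finite F \<and> {\<beta> \<in> carrier I_inf_Z. \<forall>x\<in>F. \<beta> x = \<alpha> x} \<subseteq> S"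
      using F(2) U(3) by (meson subset_trans)
  qed
next
  assume R: ?R
  have "\<exists>U\<in>tau_W_base. \<alpha> \<in> U \<and> U \<subseteq> S" if "\<alpha> \<in> S" for \<alpha>
  proof -
    obtain F where F: "finite F" "{\<beta> \<in> carrier I_inf_Z. \<forall>x\<in>F. \<beta> x = \<alpha> x} \<subseteq> S"
      using R \<open>\<alpha> \<in> S\<close> by blast
    have a: "\<alpha> \<in> carrier I_inf_Z" using R that by blast
    \<comment> \<open>Only the points of \<open>F\<close> in \<open>dom \<alpha>\<close> may index a
      base set. At the remaining points of \<open>F\<close> the inclusion of domains already makes
      both values \<open>None\<close>.\<close>
    have "\<beta> x = \<alpha> x" if "\<beta> \<in> U_nbhd \<alpha> (F \<inter> dom \<alpha>)" "x \<in> F" for \<beta> x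
      using that by (cases "x \<in> dom \<alpha>") (auto simp: U_nbhd_def domIff)
    moreover have "U_nbhd \<alpha> (F \<inter> dom \<alpha>) \<subseteq> carrier I_inf_Z" by (auto simp: U_nbhd_def)
    ultimately have "U_nbhd \<alpha> (F \<inter> dom \<alpha>) \<subseteq> S"
      using F(2) by blast
    moreover have "\<alpha> \<in> U_nbhd \<alpha> (F \<inter> dom \<alpha>)" using a by (simp add: U_nbhd_def)
    moreover have "U_nbhd \<alpha> (F \<inter> dom \<alpha>) \<in> tau_W_base"
      unfolding tau_W_base_def using a F(1) by blast
    ultimately show ?thesis by blast
  qed
  then have "\<Union>{U \<in> tau_W_base. U \<subseteq> S} = S" by blast
  then show "openin tau_W S"
    unfolding openin_tau_W union_of_def arbitrary_def
    by (intro exI[of _ "{U \<in> tau_W_base. U \<subseteq> S}"]) simp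
qed

lemma topspace_tau_W: "topspace tau_W = carrier I_inf_Z"
proof (rule antisym)
  show "topspace tau_W \<subseteq> carrier I_inf_Z"
    using openin_topspace[of tau_W] unfolding openin_tau_W_iff by blast
  have "openin tau_W (carrier I_inf_Z)"
    by (auto simp: openin_tau_W_iff)
  then show "carrier I_inf_Z \<subseteq> topspace tau_W" by (rule openin_subset)
qed

text \<open>Agreement on \<open>F\<close> is transitive, so the same \<open>F\<close> witnesses
  openness around every member.\<close>

lemma openin_tau_W_agree:
  assumes "finite F"
  shows "openin tau_W {\<beta> \<in> carrier I_inf_Z. \<forall>x\<in>F. \<beta> x = \<alpha> x}"
  unfolding openin_tau_W_iff
proof (intro conjI ballI exI)
  fix \<beta> assume "\<beta> \<in> {\<beta> \<in> carrier I_inf_Z. \<forall>x\<in>F. \<beta> x = \<alpha> x}"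
  then show "{\<gamma> \<in> carrier I_inf_Z. \<forall>x\<in>F. \<gamma> x = \<beta> x} \<subseteq> {\<beta> \<in> carrier I_inf_Z. \<forall>x\<in>F. \<beta> x = \<alpha> x}"
    by force
qed (use assms in blast)+

lemma tau_W_eq_pointwise:
  "tau_W = subtopology (product_topology (\<lambda>_. discrete_topology UNIV) UNIV) (carrier I_inf_Z)"
  (is "_ = subtopology ?P _")
proof (rule topology_eq[THEN iffD2], intro allI iffI)
  fix S assume S: "openin tau_W S"
  have "\<exists>T. openin ?P T \<and> \<alpha> \<in> T \<and> T \<inter> carrier I_inf_Z \<subseteq> S" if "\<alpha> \<in> S" for \<alpha>
  proof -
    obtain F where F: "finite F" "{\<beta> \<in> carrier I_inf_Z. \<forall>x\<in>F. \<beta> x = \<alpha> x} \<subseteq> S"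
      using S \<open>\<alpha> \<in> S\<close> unfolding openin_tau_W_iff by blast
    \<comment> \<open>The box fixes the coordinates in \<open>F\<close> and leaves all others free,
      so it is open in the product and its trace on the carrier is the agreement set.\<close>
    let ?U = "\<lambda>x. if x \<in> F then {\<alpha> x} else UNIV"
    have "finite {x. ?U x \<noteq> UNIV}" by (rule finite_subset[OF _ F(1)]) auto
    then have "openin ?P (PiE UNIV ?U)" by (simp add: openin_PiE_gen)
    moreover have "\<alpha> \<in> PiE UNIV ?U" by auto
    moreover have "\<beta> x = \<alpha> x" if "\<beta> \<in> PiE UNIV ?U" "x \<in> F" for \<beta> x
      using PiE_mem[OF that(1) UNIV_I, of x] that(2) by simp
    then have "PiE UNIV ?U \<inter> carrier I_inf_Z \<subseteq> S"
      using F(2) by blast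
    ultimately show ?thesis by blast
  qed
  then obtain T where T: "\<And>\<alpha>. \<alpha> \<in> S \<Longrightarrow> openin ?P (T \<alpha>) \<and> \<alpha> \<in> T \<alpha> \<and> T \<alpha> \<inter> carrier I_inf_Z \<subseteq> S"
    by metis
  then have "S = (\<Union>\<alpha>\<in>S. T \<alpha>) \<inter> carrier I_inf_Z"
    using S unfolding openin_tau_W_iff by blast
  moreover have "openin ?P (\<Union>\<alpha>\<in>S. T \<alpha>)"
    using T by (intro openin_Union) auto
  ultimately show "openin (subtopology ?P (carrier I_inf_Z)) S"
    unfolding openin_subtopology by blast
next
  fix S assume "openin (subtopology ?P (carrier I_inf_Z)) S"
  then obtain T where T: "openin ?P T" and ST: "S = T \<inter> carrier I_inf_Z"
    by (auto simp: openin_subtopology)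
  show "openin tau_W S"
    unfolding openin_tau_W_iff
  proof (intro conjI ballI)
    show "S \<subseteq> carrier I_inf_Z" using ST by blast
    fix \<alpha> assume "\<alpha> \<in> S"
    then obtain U where U: "finite {x. U x \<noteq> UNIV}" "\<alpha> \<in> PiE UNIV U" "PiE UNIV U \<subseteq> T"
      using T ST unfolding openin_product_topology_alt by fastforce
    \<comment> \<open>Only finitely many sides of the box are proper; agreeing with its member
      \<alpha> on those coordinates is enough to stay inside.\<close>
    have "\<beta> \<in> T" if "\<forall>x\<in>{x. U x \<noteq> UNIV}. \<beta> x = \<alpha> x" for \<beta>
    proof -
      have "\<beta> x \<in> U x" for x
        using that U(2) by (cases "U x = UNIV") (auto simp: PiE_UNIV_domain Pi_def)
      then show ?thesis using U(3) by (auto simp: PiE_UNIV_domain)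
    qed
    then show "\<exists>F. finite F \<and> {\<beta> \<in> carrier I_inf_Z. \<forall>x\<in>F. \<beta> x = \<alpha> x} \<subseteq> S"
      using U(1) ST by (intro exI[of _ "{x. U x \<noteq> UNIV}"]) blast
  qed
qed

lemma Hausdorff_tau_W: "Hausdorff_space tau_W"
  unfolding tau_W_eq_pointwise
  by (simp add: Hausdorff_space_subtopology Hausdorff_space_product_topology)

lemma completely_regular_tau_W: "completely_regular_space tau_W"
  unfolding tau_W_eq_pointwise
  by (simp add: completely_regular_space_subtopology completely_regular_space_product_topology
      completely_regular_space_discrete_topology)

text \<open>Continuity into a subspace of a product is checked coordinatewise, and each coordinate
  is discrete, so local constancy of every single value \<open>f p x\<close> suffices.\<close>

lemma continuous_map_tau_WI:
  assumes "\<And>p. p \<in> topspace X \<Longrightarrow> f p \<in> carrier I_inf_Z"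
    and "\<And>x p. p \<in> topspace X \<Longrightarrow> \<exists>U. openin X U \<and> p \<in> U \<and> (\<forall>q\<in>U. f q x = f p x)"
  shows "continuous_map X tau_W f"
  unfolding tau_W_eq_pointwise continuous_map_in_subtopology continuous_map_componentwise_UNIV
    continuous_map_discrete_iff
  using assms by blast


section \<open>Continuity of the operations\<close>

lemma continuous_map_mult:
  "continuous_map (prod_topology tau_W tau_W) tau_W (\<lambda>(\<alpha>, \<beta>). \<alpha> \<otimes>\<^bsub>I_inf_Z\<^esub> \<beta>)"
proof (rule continuous_map_tau_WI)
  fix p assume "p \<in> topspace (prod_topology tau_W tau_W)"
  then obtain \<alpha> \<beta> where p: "p = (\<alpha>, \<beta>)" "\<alpha> \<in> carrier I_inf_Z" "\<beta> \<in> carrier I_inf_Z"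
    by (auto simp: topspace_tau_W)
  then show "(case p of (\<alpha>, \<beta>) \<Rightarrow> \<alpha> \<otimes>\<^bsub>I_inf_Z\<^esub> \<beta>) \<in> carrier I_inf_Z"
    using monoid.m_closed[OF monoid_I_inf_Z] by simp
  fix x
  let ?A = "{\<alpha>' \<in> carrier I_inf_Z. \<forall>z\<in>{x}. \<alpha>' z = \<alpha> z}"
  \<comment> \<open>\<open>set_option (\<alpha> x)\<close> contains the one point at which \<beta>
    is evaluated, and is empty when \<alpha> is undefined at x: the product is then undefined at x
    whatever the second factor.\<close>
  let ?B = "{\<beta>' \<in> carrier I_inf_Z. \<forall>z\<in>set_option (\<alpha> x). \<beta>' z = \<beta> z}"
  have "openin (prod_topology tau_W tau_W) (?A \<times> ?B)"
    by (intro openin_prod_Times_iff[THEN iffD2] disjI2 conjI openin_tau_W_agree) simp_all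
  moreover have "p \<in> ?A \<times> ?B" using p by simp
  moreover have "\<forall>q\<in>?A \<times> ?B. (case q of (\<alpha>, \<beta>) \<Rightarrow> \<alpha> \<otimes>\<^bsub>I_inf_Z\<^esub> \<beta>) x = (case p of (\<alpha>, \<beta>) \<Rightarrow> \<alpha> \<otimes>\<^bsub>I_inf_Z\<^esub> \<beta>) x"
    by (auto simp: p(1) mult_eq map_comp_def split: option.splits)
  ultimately show "\<exists>U. openin (prod_topology tau_W tau_W) U \<and> p \<in> U \<and>
      (\<forall>q\<in>U. (case q of (\<alpha>, \<beta>) \<Rightarrow> \<alpha> \<otimes>\<^bsub>I_inf_Z\<^esub> \<beta>) x = (case p of (\<alpha>, \<beta>) \<Rightarrow> \<alpha> \<otimes>\<^bsub>I_inf_Z\<^esub> \<beta>) x)"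
    by blast
qed

text \<open>Both rays around y are infinite, whereas the range misses only finitely many integers;
  so values of \<alpha> lie on either side of y.\<close>

lemma carrier_unbounded:
  assumes "\<alpha> \<in> carrier I_inf_Z"
  obtains a b u v where "\<alpha> a = Some u" "u < y" "\<alpha> b = Some v" "y < v"
proof -
  have fin: "finite (- ran \<alpha>)" using assms by (simp add: carrier_iff)
  have "\<not> {..<y} \<subseteq> - ran \<alpha>" "\<not> {y<..} \<subseteq> - ran \<alpha>"
    using finite_subset[OF _ fin] infinite_Iio infinite_Ioi by blast+
  then show thesis using that by (auto simp: ran_def)
qed

text \<open>Supplies the neighbourhood for the coordinate y of the inversion. If y is a value of
  \<alpha>, fixing its preimage suffices; otherwise a whole interval has to be fixed.\<close>

lemma map_inverse_locally_constant:
  assumes a: "\<alpha> \<in> carrier I_inf_Z"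
  shows "\<exists>F. finite F \<and>
    (\<forall>\<beta>\<in>carrier I_inf_Z. (\<forall>x\<in>F. \<beta> x = \<alpha> x) \<longrightarrow> map_inverse \<beta> y = map_inverse \<alpha> y)"
proof (cases "map_inverse \<alpha> y")
  case (Some x)
  then have "\<alpha> x = Some y" by (simp add: map_inverse_eq_Some_iff[OF a])
  then have "map_inverse \<beta> y = Some x" if "\<beta> \<in> carrier I_inf_Z" "\<beta> x = \<alpha> x" for \<beta>
    using that by (simp add: map_inverse_eq_Some_iff)
  then show ?thesis using Some by (intro exI[of _ "{x}"]) simp
next
  case None
  obtain l r u v where lr: "\<alpha> l = Some u" "u < y" "\<alpha> r = Some v" "y < v"
    using carrier_unbounded[OF a] .
  have "map_inverse \<beta> y = None"
    if b: "\<beta> \<in> carrier I_inf_Z" and eq: "\<forall>x\<in>{l..r}. \<beta> x = \<alpha> x" for \<beta>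
  proof (rule ccontr)
    assume "map_inverse \<beta> y \<noteq> None"
    then obtain x where x: "\<beta> x = Some y" by (auto simp: map_inverse_eq_Some_iff[OF b])
    \<comment> \<open>Since the interval is nonempty, its endpoints belong to it, so \<beta> also
      takes the values u and v there. A preimage of y under \<beta> is then trapped between l and r,
      where \<beta> agrees with \<alpha>, so y would be a value of \<alpha>.\<close>
    have "l < r" using carrier_less_iff[OF a] lr by (meson less_trans)
    then have "\<beta> l = Some u" "\<beta> r = Some v" using eq lr by simp_all
    then have "l < x" "x < r" using carrier_less_iff[OF b] x lr by blast+
    then have "\<alpha> x = Some y" using eq x by simp
    then show False using None map_inverse_eq_Some_iff[OF a] by force
  qed
  then show ?thesis using None by (intro exI[of _ "{l..r}"]) simp
qed

lemma continuous_map_semigroup_inv: "continuous_map tau_W tau_W (semigroup_inv I_inf_Z)"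
proof (rule continuous_map_tau_WI)
  fix \<alpha> assume "\<alpha> \<in> topspace tau_W"
  then have a: "\<alpha> \<in> carrier I_inf_Z" by (simp add: topspace_tau_W)
  then show "semigroup_inv I_inf_Z \<alpha> \<in> carrier I_inf_Z"
    by (simp add: semigroup_inv_eq map_inverse_closed)
  fix y
  obtain F where F: "finite F" "\<And>\<beta>. \<beta> \<in> carrier I_inf_Z \<Longrightarrow> \<forall>x\<in>F. \<beta> x = \<alpha> x \<Longrightarrow>
      map_inverse \<beta> y = map_inverse \<alpha> y"
    using map_inverse_locally_constant[OF a, of y] by blast
  let ?U = "{\<beta> \<in> carrier I_inf_Z. \<forall>x\<in>F. \<beta> x = \<alpha> x}"
  have "semigroup_inv I_inf_Z \<beta> y = semigroup_inv I_inf_Z \<alpha> y" if "\<beta> \<in> ?U" for \<beta>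
    using that a F(2)[of \<beta>] by (simp add: semigroup_inv_eq)
  moreover have "openin tau_W ?U" using F(1) by (rule openin_tau_W_agree)
  moreover have "\<alpha> \<in> ?U" using a by simp
  ultimately show "\<exists>U. openin tau_W U \<and> \<alpha> \<in> U \<and>
      (\<forall>\<beta>\<in>U. semigroup_inv I_inf_Z \<beta> y = semigroup_inv I_inf_Z \<alpha> y)"
    by blast
qed

theorem proposition4p5:
  shows "tychonoff_space tau_W \<and> topological_inverse_semigroup I_inf_Z tau_W"
proof
  show "tychonoff_space tau_W"
    by (simp add: tychonoff_space_def completely_regular_tau_W Hausdorff_imp_t1_space Hausdorff_tau_W)
  show "topological_inverse_semigroup I_inf_Z tau_W"
    by (intro topological_inverse_semigroup.intro inverse_semigroup_I_inf_Z
        topological_inverse_semigroup_axioms.intro topspace_tau_W Hausdorff_tau_W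
        continuous_map_mult continuous_map_semigroup_inv)
qed

end
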